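(* Let $G$ and $H$ be two non-trivial connected graphs of order $m$ and $n$, respectively. Then $$\min\{m,n\}\leq \widetilde{\gamma}_{wcon}(G\Box H)\leq \min\{\widetilde{\gamma}_{wcon}(G)\,n,\ \widetilde{\gamma}_{wcon}(H)\,m\}.$$
   Context: All graphs are simple and undirected; a graph is non-trivial if it has at least two vertices, and its order is its number of vertices. A set $C\subseteq V(G)$ is a dominating set of $G$ if every vertex of $V(G)\setminus C$ is adjacent in $G$ to some vertex of $C$. For a connected graph $G$, an $x$–$y$ geodesic is a shortest $x$–$y$ path in $G$. A set $C\subseteq V(G)$ is weakly convex if for every $x,y\in C$ there is an $x$–$y$ geodesic of $G$ all of whose vertices are in $C$ (so the empty set is vacuously weakly convex). A set $D\subseteq V(G)$ is an outer-weakly convex dominating set of $G$ if it is a dominating set of $G$ and $V(G)\setminus D$ is weakly convex in $G$. The outer-weakly convex domination number $\widetilde{\gamma}_{wcon}(G)$ is the minimum cardinality of an outer-weakly convex dominating set of $G$. The Cartesian product $G\Box H$ has vertex set $V(G)\times V(H)$, with $(g,h)$ and $(g',h')$ adjacent if and only if either $gg'\in E(G)$ and $h=h'$, or $g=g'$ and $hh'\in E(H)$. *)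

theory Defs
  imports "Graph_Theory.Digraph_Component_Vwalk"
begin

text \<open>
  A finite simple undirected graph is a \<^locale>\<open>pair_graph\<close>: its arc set is a finite, symmetric and
  irreflexive set of ordered pairs of vertices, so an edge \<open>uv\<close> is the pair of arcs \<open>(u, v)\<close>, \<open>(v, u)\<close>.
\<close>

definition dominating_set :: "('a, 'b) pre_digraph \<Rightarrow> 'a set \<Rightarrow> bool" where
  "dominating_set G C \<longleftrightarrow>
     C \<subseteq> verts G \<and> (\<forall>v \<in> verts G - C. \<exists>u \<in> C. v \<rightarrow>\<^bsub>G\<^esub> u)"

definition geodesic :: "('a, 'b) pre_digraph \<Rightarrow> 'a \<Rightarrow> 'a \<Rightarrow> 'a vwalk \<Rightarrow> bool" where
  "geodesic G x y p \<longleftrightarrow>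
     vpath p G \<and> hd p = x \<and> last p = y \<and>
     (\<forall>q. vpath q G \<and> hd q = x \<and> last q = y \<longrightarrow> vwalk_length p \<le> vwalk_length q)"

definition weakly_convex :: "('a, 'b) pre_digraph \<Rightarrow> 'a set \<Rightarrow> bool" where
  "weakly_convex G C \<longleftrightarrow>
     C \<subseteq> verts G \<and> (\<forall>x \<in> C. \<forall>y \<in> C. \<exists>p. geodesic G x y p \<and> set p \<subseteq> C)"

definition outer_weakly_convex_dominating :: "('a, 'b) pre_digraph \<Rightarrow> 'a set \<Rightarrow> bool" where
  "outer_weakly_convex_dominating G D \<longleftrightarrow>
     dominating_set G D \<and> weakly_convex G (verts G - D)"

definition outer_weakly_convex_domination_number :: "('a, 'b) pre_digraph \<Rightarrow> nat" where
  "outer_weakly_convex_domination_number G =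
     Min (card ` {D. outer_weakly_convex_dominating G D})"

text \<open>For a finite graph, the minimum above ranges over a finite nonempty set.\<close>

lemma outer_weakly_convex_dominating_verts: "outer_weakly_convex_dominating G (verts G)"
  by (simp add: outer_weakly_convex_dominating_def dominating_set_def weakly_convex_def)

lemma (in fin_digraph) finite_outer_weakly_convex_dominating:
  "finite {D. outer_weakly_convex_dominating G D}"
  by (rule finite_subset[of _ "Pow (verts G)"])
    (auto simp: outer_weakly_convex_dominating_def dominating_set_def)

definition cartesian_product ::
  "'a pair_pre_digraph \<Rightarrow> 'b pair_pre_digraph \<Rightarrow> ('a \<times> 'b) pair_pre_digraph" (infixr "\<box>" 75) where
  "G \<box> H =
     \<lparr> pverts = pverts G \<times> pverts H,
       parcs = {((g, h), (g', h')) | g h g' h'.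
         (g, h) \<in> pverts G \<times> pverts H \<and> (g', h') \<in> pverts G \<times> pverts H \<and>
         ((g, g') \<in> parcs G \<and> h = h' \<or> g = g' \<and> (h, h') \<in> parcs H)} \<rparr>"

lemma pair_graph_cartesian_product:
  assumes "pair_graph G" "pair_graph H"
  shows "pair_graph (G \<box> H)"
proof -
  interpret G: pair_graph G by fact
  interpret H: pair_graph H by fact
  have "parcs (G \<box> H) \<subseteq> (pverts G \<times> pverts H) \<times> (pverts G \<times> pverts H)"
    by (auto simp: cartesian_product_def)
  then have "finite (parcs (G \<box> H))"
    by (rule finite_subset) simp
  moreover have "sym (parcs (G \<box> H))"
    using G.sym_arcs H.sym_arcs
    by (auto simp: cartesian_product_def sym_def symmetric_def)
  ultimately show ?thesis
    by unfold_locales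
      (auto simp: cartesian_product_def symmetric_def dest: G.no_loops' H.no_loops')
qed

end

theory Submission
  imports Defs
begin

text \<open>
  Lower bound: a vertex \<open>(g, h)\<close> and all its neighbours lie in the row and the column through
  \<open>(g, h)\<close>, so a dominating set cannot miss both a row and a column; it therefore meets all rows or
  all columns. Upper bound: if \<open>D\<close> is optimal for \<open>G\<close>, take \<open>D \<times> V(H)\<close>. Its complement
  \<open>(V(G) - D) \<times> V(H)\<close> is weakly convex, because distances in the product are sums of distances
  in the factors, so a geodesic of \<open>G\<close> followed by one of \<open>H\<close> is a geodesic of the product.
\<close>

section \<open>Geodesics\<close>

text \<open>Shortcutting only deletes vertices: if the head \<open>x\<close> recurs, the recursion
  continues from its next occurrence, found by \<open>dropWhile\<close>.\<close>

lemma length_vwalk_to_vpath_le: "length (vwalk_to_vpath p) \<le> length p"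
proof (induct p rule: vwalk_to_vpath_induct3)
  case (in_set x xs)
  then show ?case
    using length_dropWhile_le[of "\<lambda>y. y \<noteq> x" xs] by simp
qed simp_all

text \<open>Every walk contains a path with the same ends that is no longer, so a shortest path also
  beats all walks. This form is what the product needs, since projecting a path to a factor may
  repeat vertices and yields only a walk.\<close>

lemma geodesic_iff_shortest_vwalk:
  "geodesic G x y p \<longleftrightarrow>
    vpath p G \<and> hd p = x \<and> last p = y \<and>
    (\<forall>q. vwalk q G \<and> hd q = x \<and> last q = y \<longrightarrow> length p \<le> length q)"
proof -
  have vwalk_bound: "length p \<le> length q"
    if p: "geodesic G x y p" and q: "vwalk q G" "hd q = x" "last q = y" for q
  proof -
    have "vpath (vwalk_to_vpath q) G"
      "hd (vwalk_to_vpath q) = x" "last (vwalk_to_vpath q) = y"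
      using q by (simp_all add: vwalk_to_vpath_vpath vwalk_to_vpath_hd vwalk_to_vpath_last)
    with p have "length p - 1 \<le> length (vwalk_to_vpath q) - 1"
      by (simp add: geodesic_def)
    \<comment> \<open>Subtraction on naturals truncates at 0, so the 1 can be cancelled only once
      the shortcut is known to be nonempty.\<close>
    moreover have "vwalk_to_vpath q \<noteq> []"
      using q by (intro vwalk_to_vpath_nonempty) auto
    ultimately have "length p \<le> length (vwalk_to_vpath q)"
      by (cases "vwalk_to_vpath q") auto
    then show ?thesis
      using length_vwalk_to_vpath_le[of q] by linarith
  qed
  show ?thesis
    using vwalk_bound by (auto simp: geodesic_def vpath_def diff_le_mono)
qed

lemma geodesic_exists:
  assumes "vwalk q G" "hd q = x" "last q = y"
  shows "\<exists>p. geodesic G x y p"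
proof -
  let ?P = "\<lambda>p. vpath p G \<and> hd p = x \<and> last p = y"
  have "\<exists>p. ?P p"
    using assms by (rule vwalk_imp_ex_vpath)
  then have "\<exists>p. ?P p \<and> (\<forall>q. ?P q \<longrightarrow> vwalk_length p \<le> vwalk_length q)"
    using ex_has_least_nat[of ?P _ vwalk_length] by blast
  then show ?thesis
    unfolding geodesic_def by blast
qed

text \<open>Supplies the full factor in the complement \<open>(V(G) - D) \<times> V(H)\<close>.
  Since arcs are symmetric, connectedness gives a walk between any two vertices, hence a
  geodesic.\<close>

lemma (in pair_graph) weakly_convex_verts:
  assumes "Digraph_Component.connected (with_proj G)"
  shows "weakly_convex (with_proj G) (pverts G)"
proof -
  have sc: "strongly_connected (with_proj G)"
    using sym_arcs assms by (rule symmetric_connected_imp_strongly_connected)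
  have "\<exists>p. geodesic (with_proj G) x y p \<and> set p \<subseteq> pverts G"
    if "x \<in> pverts G" "y \<in> pverts G" for x y
  proof -
    have "x \<rightarrow>\<^sup>*\<^bsub>with_proj G\<^esub> y"
      using sc that by auto
    then obtain q where q: "vwalk q (with_proj G)" "hd q = x" "last q = y"
      unfolding reachable_vwalk_conv by blast
    obtain p where p: "geodesic (with_proj G) x y p"
      using geodesic_exists[OF q] by (rule exE)
    then have "vwalk p (with_proj G)"
      by (simp add: geodesic_def vpath_def)
    then have "set p \<subseteq> pverts G"
      by (simp add: vwalk_def)
    with p show ?thesis by (intro exI conjI)
  qed
  then show ?thesis
    by (simp add: weakly_convex_def)
qed

section \<open>Walks in the Cartesian product\<close>

lemma pverts_cartesian_product [simp]: "pverts (G \<box> H) = pverts G \<times> pverts H"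
  by (simp add: cartesian_product_def)

lemma parcs_cartesian_product_iff:
  "((g, h), (g', h')) \<in> parcs (G \<box> H) \<longleftrightarrow>
    g \<in> pverts G \<and> g' \<in> pverts G \<and> h \<in> pverts H \<and> h' \<in> pverts H \<and>
    ((g, g') \<in> parcs G \<and> h = h' \<or> g = g' \<and> (h, h') \<in> parcs H)"
  by (auto simp: cartesian_product_def)

context pair_wf_digraph
begin

lemma vwalk_cartesian_product_left:
  assumes "vwalk p (with_proj G)" "h \<in> pverts H"
  shows "vwalk (map (\<lambda>g. (g, h)) p) (with_proj (G \<box> H))"
  using assms(1)
proof (induct p)
  case (Base u)
  then show ?case using assms(2) by (auto simp: vwalk_def)
next
  case (Cons u v es)
  then have "vwalk ((u, h) # map (\<lambda>g. (g, h)) (v # es)) (with_proj (G \<box> H))"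
    using assms(2)
    by (intro vwalk_consI) (auto simp: parcs_cartesian_product_iff dest: wellformed')
  then show ?case by simp
qed

lemma vwalk_cartesian_product_right:
  assumes "vwalk p (with_proj G)" "h \<in> pverts H"
  shows "vwalk (map (\<lambda>g. (h, g)) p) (with_proj (H \<box> G))"
  using assms(1)
proof (induct p)
  case (Base u)
  then show ?case using assms(2) by (auto simp: vwalk_def)
next
  case (Cons u v es)
  then have "vwalk ((h, u) # map (\<lambda>g. (h, g)) (v # es)) (with_proj (H \<box> G))"
    using assms(2)
    by (intro vwalk_consI) (auto simp: parcs_cartesian_product_iff dest: wellformed')
  then show ?case by simp
qed

end

text \<open>Each arc of \<open>q\<close> moves exactly one coordinate, so the arcs are shared out
  between \<open>a\<close> and \<open>b\<close>. A walk lists one vertex more than it has arcs,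
  which accounts for the \<open>Suc\<close>. This gives the lower bound on distances in the
  product.\<close>

lemma vwalk_cartesian_product_project:
  assumes "vwalk q (with_proj (G \<box> H))"
  shows "\<exists>a b. vwalk a (with_proj G) \<and> hd a = fst (hd q) \<and> last a = fst (last q) \<and>
    vwalk b (with_proj H) \<and> hd b = snd (hd q) \<and> last b = snd (last q) \<and>
    length a + length b = Suc (length q)"
  using assms
proof (induct q)
  case (Base u)
  then show ?case
    by (intro exI[of _ "[fst u]"] exI[of _ "[snd u]"]) (auto simp: vwalk_def)
next
  case (Cons u v es)
  then obtain a b where a: "vwalk a (with_proj G)" "hd a = fst v" "last a = fst (last (v # es))"
    and b: "vwalk b (with_proj H)" "hd b = snd v" "last b = snd (last (v # es))"
    and len: "length a + length b = Suc (length (v # es))"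
    by auto
  have ne: "a \<noteq> []" "b \<noteq> []"
    using a b by auto
  obtain g h g' h' where uv: "u = (g, h)" "v = (g', h')"
    by (metis surj_pair)
  \<comment> \<open>The first arc prolongs the walk in the coordinate it moves; the other walk
    already starts at the right vertex.\<close>
  from Cons(1) consider
      "g \<in> pverts G" "(g, g') \<in> parcs G" "h = h'"
    | "h \<in> pverts H" "(h, h') \<in> parcs H" "g = g'"
    by (auto simp: uv parcs_cartesian_product_iff)
  then show ?case
  proof cases
    case 1
    then have "vwalk (g # a) (with_proj G)"
      using a uv by (intro vwalk_consI) auto
    then show ?thesis
      using a b len uv 1 ne by (intro exI[of _ "g # a"] exI[of _ b]) auto
  next
    case 2
    then have "vwalk (h # b) (with_proj H)"
      using b uv by (intro vwalk_consI) auto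
    then show ?thesis
      using a b len uv 2 ne by (intro exI[of _ a] exI[of _ "h # b"]) auto
  qed
qed

text \<open>Walk along \<open>p\<close> in the layer of \<open>h\<close>, turn at the corner
  \<open>(g', h)\<close>, then follow \<open>q\<close> in the layer of \<open>g'\<close>. Any rival
  walk projects to walks in the factors that are at least as long as \<open>p\<close> and
  \<open>q\<close>.\<close>

lemma geodesic_cartesian_product:
  assumes "pair_graph G" "pair_graph H"
    and p: "geodesic (with_proj G) g g' p" and q: "geodesic (with_proj H) h h' q"
  shows "geodesic (with_proj (G \<box> H)) (g, h) (g', h')
    (map (\<lambda>x. (x, h)) p \<oplus> map (\<lambda>y. (g', y)) q)"
proof -
  interpret G: pair_graph G by fact
  interpret H: pair_graph H by fact
  let ?l = "map (\<lambda>x. (x, h)) p" and ?r = "map (\<lambda>y. (g', y)) q"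
  have p': "vwalk p (with_proj G)" "distinct p" "hd p = g" "last p = g'" "p \<noteq> []"
    and q': "vwalk q (with_proj H)" "distinct q" "hd q = h" "last q = h'" "q \<noteq> []"
    using p q by (auto simp: geodesic_def vpath_def)
  have "h \<in> pverts H" "g' \<in> pverts G"
    using p' q' by (auto simp: vwalk_def)
  then have l: "vwalk ?l (with_proj (G \<box> H))" and r: "vwalk ?r (with_proj (G \<box> H))"
    using p' q' by (simp_all add: G.vwalk_cartesian_product_left H.vwalk_cartesian_product_right)
  have join: "joinable ?l ?r"
    using p' q' by (simp add: joinable_def hd_map last_map)
  have "vwalk (?l \<oplus> ?r) (with_proj (G \<box> H))"
    using l r join by (rule vwalk_joinI_vwalk)
  \<comment> \<open>The join keeps the corner only once. The rest of the second piece avoids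
    \<open>h\<close> in the second coordinate, so it is disjoint from the first piece.\<close>
  moreover have "h \<notin> set (tl q)" "distinct (tl q)"
    using q' by (cases q; auto)+
  then have "distinct (?l \<oplus> ?r)"
    using p' by (auto simp: vwalk_join_def distinct_map inj_on_def map_tl[symmetric])
  moreover have "hd (?l \<oplus> ?r) = (g, h)" "last (?l \<oplus> ?r) = (g', h')"
    using join p' q' by (simp_all add: vwalk_join_hd vwalk_join_last hd_map last_map)
  moreover have "length (?l \<oplus> ?r) \<le> length w"
    if w: "vwalk w (with_proj (G \<box> H))" "hd w = (g, h)" "last w = (g', h')" for w
  proof -
    obtain a b where "vwalk a (with_proj G)" "hd a = g" "last a = g'"
      "vwalk b (with_proj H)" "hd b = h" "last b = h'"
      and len: "length a + length b = Suc (length w)"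
      using vwalk_cartesian_product_project[OF w(1)] w by auto
    then have "length p \<le> length a" "length q \<le> length b"
      using p q by (auto simp: geodesic_iff_shortest_vwalk)
    \<comment> \<open>The shared corner makes the join one shorter than \<open>p\<close> and
      \<open>q\<close> together, matching the \<open>Suc\<close> in \<open>len\<close>.\<close>
    with len q' show ?thesis
      by (cases q) (auto simp: vwalk_join_def)
  qed
  ultimately show ?thesis
    by (auto simp: geodesic_iff_shortest_vwalk vpath_def)
qed

text \<open>The geodesic with one corner takes its first coordinates from \<open>p\<close> and its
  second coordinates from \<open>q\<close>, so it never leaves \<open>A \<times> B\<close>.\<close>

lemma weakly_convex_Times:
  assumes "pair_graph G" "pair_graph H"
    and A: "weakly_convex (with_proj G) A" and B: "weakly_convex (with_proj H) B"
  shows "weakly_convex (with_proj (G \<box> H)) (A \<times> B)"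
proof -
  have "\<exists>w. geodesic (with_proj (G \<box> H)) (g, h) (g', h') w \<and> set w \<subseteq> A \<times> B"
    if "g \<in> A" "h \<in> B" "g' \<in> A" "h' \<in> B" for g h g' h'
  proof -
    obtain p where p: "geodesic (with_proj G) g g' p" "set p \<subseteq> A"
      using A \<open>g \<in> A\<close> \<open>g' \<in> A\<close> unfolding weakly_convex_def by meson
    obtain q where q: "geodesic (with_proj H) h h' q" "set q \<subseteq> B"
      using B \<open>h \<in> B\<close> \<open>h' \<in> B\<close> unfolding weakly_convex_def by meson
    have "set (map (\<lambda>x. (x, h)) p \<oplus> map (\<lambda>y. (g', y)) q) \<subseteq> A \<times> B"
      using p q that by (cases q) (auto simp: vwalk_join_def)
    with geodesic_cartesian_product[OF assms(1,2) p(1) q(1)] show ?thesis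
      by blast
  qed
  then show ?thesis
    using A B by (auto simp: weakly_convex_def)
qed

section \<open>Domination in the Cartesian product\<close>

lemma dominating_set_cartesian_product_card:
  assumes "finite (pverts G)" "finite (pverts H)"
    and D: "dominating_set (with_proj (G \<box> H)) D"
  shows "min (card (pverts G)) (card (pverts H)) \<le> card D"
proof -
  have sub: "D \<subseteq> pverts G \<times> pverts H"
    using D by (simp add: dominating_set_def)
  then have fin: "finite D"
    using assms finite_subset by blast
  \<comment> \<open>One projection of \<open>D\<close> is onto its factor. Otherwise some
    \<open>(g, h)\<close> shares no coordinate with any element of \<open>D\<close>, whereas a
    neighbour in \<open>D\<close> would share one.\<close>
  have "pverts G \<subseteq> fst ` D \<or> pverts H \<subseteq> snd ` D"
  proof (rule ccontr)
    assume "\<not> ?thesis"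
    then obtain g h where gh: "g \<in> pverts G" "g \<notin> fst ` D" "h \<in> pverts H" "h \<notin> snd ` D"
      by blast
    have "(g, h) \<in> pverts G \<times> pverts H - D"
      using gh by force
    moreover have "\<forall>v \<in> pverts G \<times> pverts H - D. \<exists>u \<in> D. (v, u) \<in> parcs (G \<box> H)"
      using D by (simp add: dominating_set_def)
    ultimately obtain d where "d \<in> D" "((g, h), d) \<in> parcs (G \<box> H)"
      by (meson bspec)
    moreover obtain g' h' where "d = (g', h')"
      by (rule prod.exhaust)
    ultimately show False
      using gh by (force simp: parcs_cartesian_product_iff)
  qed
  then show ?thesis
  proof
    assume "pverts G \<subseteq> fst ` D"
    then have "card (pverts G) \<le> card D"
      using fin by (rule surj_card_le[rotated])
    then show ?thesis by simp
  next
    assume "pverts H \<subseteq> snd ` D"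
    then have "card (pverts H) \<le> card D"
      using fin by (rule surj_card_le[rotated])
    then show ?thesis by simp
  qed
qed

text \<open>A vertex \<open>(g, h)\<close> outside has \<open>g\<close> outside \<open>D\<close>; if
  \<open>d\<close> in \<open>D\<close> dominates \<open>g\<close>, then \<open>(d, h)\<close>
  dominates \<open>(g, h)\<close> within the same layer.\<close>

lemma dominating_set_Times_verts:
  assumes "dominating_set (with_proj G) D"
  shows "dominating_set (with_proj (G \<box> H)) (D \<times> pverts H)"
  using assms by (fastforce simp: dominating_set_def parcs_cartesian_product_iff)

lemma dominating_set_verts_Times:
  assumes "dominating_set (with_proj H) D"
  shows "dominating_set (with_proj (G \<box> H)) (pverts G \<times> D)"
  using assms by (fastforce simp: dominating_set_def parcs_cartesian_product_iff)

lemma outer_weakly_convex_dominating_Times_verts: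
  assumes "pair_graph G" "pair_graph H"
    and "Digraph_Component.connected (with_proj H)"
    and D: "outer_weakly_convex_dominating (with_proj G) D"
  shows "outer_weakly_convex_dominating (with_proj (G \<box> H)) (D \<times> pverts H)"
proof -
  \<comment> \<open>The complement is again a product of weakly convex sets: the first factor by the
    choice of \<open>D\<close>, the second by connectedness of \<open>H\<close>.\<close>
  have "pverts G \<times> pverts H - D \<times> pverts H = (pverts G - D) \<times> pverts H"
    by auto
  moreover have "weakly_convex (with_proj (G \<box> H)) ((pverts G - D) \<times> pverts H)"
    using D assms
    by (simp add: weakly_convex_Times pair_graph.weakly_convex_verts
        outer_weakly_convex_dominating_def)
  ultimately show ?thesis
    using D by (simp add: outer_weakly_convex_dominating_def dominating_set_Times_verts)
qed

lemma outer_weakly_convex_dominating_verts_Times: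
  assumes "pair_graph G" "pair_graph H"
    and "Digraph_Component.connected (with_proj G)"
    and D: "outer_weakly_convex_dominating (with_proj H) D"
  shows "outer_weakly_convex_dominating (with_proj (G \<box> H)) (pverts G \<times> D)"
proof -
  have "pverts G \<times> pverts H - pverts G \<times> D = pverts G \<times> (pverts H - D)"
    by auto
  moreover have "weakly_convex (with_proj (G \<box> H)) (pverts G \<times> (pverts H - D))"
    using D assms
    by (simp add: weakly_convex_Times pair_graph.weakly_convex_verts
        outer_weakly_convex_dominating_def)
  ultimately show ?thesis
    using D by (simp add: outer_weakly_convex_dominating_def dominating_set_verts_Times)
qed

context fin_digraph
begin

text \<open>The family under \<open>Min\<close> is finite and contains \<open>verts G\<close>, so
  the minimum is a genuine one.\<close>

lemma outer_weakly_convex_domination_number_attained: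
  obtains D where "outer_weakly_convex_dominating G D"
    "card D = outer_weakly_convex_domination_number G"
proof -
  have "outer_weakly_convex_domination_number G \<in> card ` {D. outer_weakly_convex_dominating G D}"
    unfolding outer_weakly_convex_domination_number_def
    using finite_outer_weakly_convex_dominating outer_weakly_convex_dominating_verts
    by (intro Min_in) auto
  then show ?thesis
    using that by auto
qed

lemma outer_weakly_convex_domination_number_le:
  assumes "outer_weakly_convex_dominating G D"
  shows "outer_weakly_convex_domination_number G \<le> card D"
  unfolding outer_weakly_convex_domination_number_def
  using finite_outer_weakly_convex_dominating assms by (intro Min_le) auto

end

theorem theorem2:
  fixes G :: "'a pair_pre_digraph" and H :: "'b pair_pre_digraph" and m n :: nat
  assumes "pair_graph G" and "pair_graph H"
    and "Digraph_Component.connected (with_proj G)"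
    and "Digraph_Component.connected (with_proj H)"
    and "card (pverts G) = m" and "card (pverts H) = n"
    and "m \<ge> 2" and "n \<ge> 2"
  shows "min m n \<le> outer_weakly_convex_domination_number (with_proj (G \<box> H)) \<and>
    outer_weakly_convex_domination_number (with_proj (G \<box> H)) \<le>
      min (outer_weakly_convex_domination_number (with_proj G) * n)
          (outer_weakly_convex_domination_number (with_proj H) * m)"
proof -
  interpret G: pair_graph G by fact
  interpret H: pair_graph H by fact
  interpret P: pair_graph "G \<box> H"
    using assms(1,2) by (rule pair_graph_cartesian_product)
  have "min m n \<le> outer_weakly_convex_domination_number (with_proj (G \<box> H))"
  proof -
    \<comment> \<open>An optimal set of the product is in particular dominating, so the projection
      argument bounds its size.\<close>
    obtain D where D: "outer_weakly_convex_dominating (with_proj (G \<box> H)) D"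
      "card D = outer_weakly_convex_domination_number (with_proj (G \<box> H))"
      by (rule P.outer_weakly_convex_domination_number_attained)
    then have "dominating_set (with_proj (G \<box> H)) D"
      by (simp add: outer_weakly_convex_dominating_def)
    then show ?thesis
      using dominating_set_cartesian_product_card[of G H D] assms D(2) by simp
  qed
  moreover have "outer_weakly_convex_domination_number (with_proj (G \<box> H)) \<le>
    outer_weakly_convex_domination_number (with_proj G) * n"
  proof -
    \<comment> \<open>An optimal \<open>D\<close> of the factor, repeated in each of the
      \<open>n\<close> layers, is a candidate for the product.\<close>
    obtain D where D: "outer_weakly_convex_dominating (with_proj G) D"
      "card D = outer_weakly_convex_domination_number (with_proj G)"
      by (rule G.outer_weakly_convex_domination_number_attained)
    have "outer_weakly_convex_domination_number (with_proj (G \<box> H)) \<le> card (D \<times> pverts H)"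
      using assms D(1)
      by (intro P.outer_weakly_convex_domination_number_le
          outer_weakly_convex_dominating_Times_verts)
    then show ?thesis
      using D(2) assms by (simp add: card_cartesian_product)
  qed
  moreover have "outer_weakly_convex_domination_number (with_proj (G \<box> H)) \<le>
    outer_weakly_convex_domination_number (with_proj H) * m"
  proof -
    obtain D where D: "outer_weakly_convex_dominating (with_proj H) D"
      "card D = outer_weakly_convex_domination_number (with_proj H)"
      by (rule H.outer_weakly_convex_domination_number_attained)
    have "outer_weakly_convex_domination_number (with_proj (G \<box> H)) \<le> card (pverts G \<times> D)"
      using assms D(1)
      by (intro P.outer_weakly_convex_domination_number_le
          outer_weakly_convex_dominating_verts_Times)
    then show ?thesis
      using D(2) assms by (simp add: card_cartesian_product mult.commute)
  qed
  ultimately show ?thesis by simp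
qed

end
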